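(* Let $m\in\mathbb{N}_0$ be even and let $a$ be any real number. Then the function $$Q(x)=e^{ax}\beta^{(m)}(x)$$ is convex for $x>0$.
   Context: Nielsen's $\beta$-function is the function $\beta:(0,\infty)\to\mathbb{R}$ defined by $\beta(x)=\int_0^1 \frac{t^{x-1}}{1+t}\,dt=\int_0^\infty\frac{e^{-xt}}{1+e^{-t}}\,dt$ for $x>0$. For $m\in\mathbb{N}_0=\{0,1,2,\dots\}$, $\beta^{(m)}$ denotes its $m$-th derivative, with $\beta^{(0)}=\beta$. *)

theory Defs
  imports "HOL-Analysis.Analysis"
begin

text \<open>
  Nielsen's beta function. Only the values for \<open>x > 0\<close> are meaningful. For \<open>0 < x < 1\<close> the
  integrand is unbounded near \<open>0\<close>; the gauge integral over the closed interval then agrees with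
  the improper integral.
\<close>

definition nielsen_beta :: "real \<Rightarrow> real" where
  "nielsen_beta x = integral {0..1} (\<lambda>t. t powr (x - 1) / (1 + t))"

end

theory Submission
  imports Defs
begin

text \<open>
  Differentiating \<open>m\<close> times under the integral sign shows that, at \<open>x > 0\<close>, the \<open>m\<close>-th derivative of
  Nielsen's beta function is the integral over \<open>0 \<le> t \<le> 1\<close> of the kernel
  \<open>t powr (x - 1) * ln t ^ m / (1 + t)\<close>. For even \<open>m\<close> the factor \<open>ln t ^ m\<close> is nonnegative, and
  \<open>exp (a * x) * t powr (x - 1) = exp ((a + ln t) * x) / t\<close> for \<open>t > 0\<close>. Multiplying the derivative by
  \<open>exp (a * x)\<close> therefore gives a mixture, with nonnegative weights, of exponentials of linear
  functions of \<open>x\<close>. Each of these is convex, whatever the sign of \<open>a + ln t\<close>, and convexity survives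
  integration.

  The analytic work lies in differentiating the integral, because the integrand may be unbounded
  near \<open>0\<close>. A second-order Taylor bound (\<open>log_kernel_taylor\<close>) dominates the error of the linear
  approximation by \<open>h\<^sup>2\<close> times a kernel of the same family with parameter \<open>x/2\<close>. That kernel is
  absolutely integrable (\<open>log_kernel_absolutely_integrable\<close>), so the difference quotient of the
  integral is within a constant times \<open>\<bar>h\<bar>\<close> of its limit (\<open>log_kernel_integral_has_derivative\<close>).
\<close>

text \<open>
  The \<open>m\<close>-th derivative in \<open>x\<close> of the integrand of Nielsen's beta function, for \<open>t > 0\<close>. At \<open>t = 0\<close>
  the convention \<open>0 powr y = 0\<close> makes it vanish, so pointwise estimates hold there trivially.
\<close>

definition log_kernel :: "nat \<Rightarrow> real \<Rightarrow> real \<Rightarrow> real" where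
  "log_kernel m x t = t powr (x - 1) * ln t ^ m / (1 + t)"

text \<open>
  Powers of the logarithm grow more slowly than any negative power of \<open>t\<close>: the bound
  \<open>\<bar>ln t\<bar> \<le> t powr (- c) / c\<close> with \<open>c = x / (2 * (m + 1))\<close>, raised to the \<open>m\<close>-th power, costs at most
  a factor \<open>t powr (- (x / 2))\<close> and leaves the integrable power \<open>t powr (x / 2 - 1)\<close>. The \<open>m + 1\<close>
  in place of \<open>m\<close> keeps \<open>c\<close> finite and positive when \<open>m = 0\<close>.
\<close>

lemma log_kernel_bound:
  assumes x: "x > 0" and t: "0 \<le> t" "t \<le> 1"
  shows "\<bar>log_kernel m x t\<bar> \<le> (2 * (real m + 1) / x) ^ m * t powr (x / 2 - 1)"
proof (cases "t = 0")
  case True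
  then show ?thesis by (simp add: log_kernel_def)
next
  case False
  with t have t0: "t > 0" by simp
  define c where "c = x / (2 * (real m + 1))"
  have c: "c > 0" using x by (simp add: c_def)
  have "ln (1 / t) \<le> (1 / t) powr c / c"
    using t0 t c by (intro ln_powr_bound) auto
  moreover have "(1 / t) powr c = t powr (- c)"
    using t0 by (simp add: powr_divide powr_minus_divide)
  ultimately have "\<bar>ln t\<bar> \<le> t powr (- c) / c"
    using t0 t by (simp add: ln_div)
  then have "\<bar>ln t\<bar> ^ m \<le> (t powr (- c) / c) ^ m"
    by (intro power_mono) auto
  also have "\<dots> = (1 / c) ^ m * t powr (- (c * m))"
    using t0 by (simp add: power_divide powr_power mult.commute)
  also have "\<dots> \<le> (1 / c) ^ m * t powr (- (x / 2))"
  proof (intro mult_left_mono powr_mono')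
    have "real m / (real m + 1) \<le> 1" by simp
    then have "x / 2 * (real m / (real m + 1)) \<le> x / 2 * 1"
      using x by (intro mult_left_mono) auto
    moreover have "c * real m = x / 2 * (real m / (real m + 1))"
      unfolding c_def by (simp add: field_simps)
    ultimately show "- (x / 2) \<le> - (c * real m)" by simp
  qed (use t0 t c in auto)
  finally have L: "\<bar>ln t\<bar> ^ m \<le> (1 / c) ^ m * t powr (- (x / 2))" .
  have "\<bar>log_kernel m x t\<bar> = t powr (x - 1) * \<bar>ln t\<bar> ^ m / (1 + t)"
    using t0 by (simp add: log_kernel_def abs_mult power_abs)
  also have "\<dots> \<le> t powr (x - 1) * \<bar>ln t\<bar> ^ m / 1"
    using t0 by (intro divide_left_mono) auto
  also have "\<dots> \<le> t powr (x - 1) * ((1 / c) ^ m * t powr (- (x / 2)))"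
    using L by (simp add: mult_left_mono)
  also have "\<dots> = (1 / c) ^ m * t powr (x / 2 - 1)"
  proof -
    have "x - 1 + - (x / 2) = x / 2 - 1" by simp
    then have "t powr (x - 1) * t powr (- (x / 2)) = t powr (x / 2 - 1)"
      by (metis powr_add)
    then show ?thesis by simp
  qed
  finally show ?thesis by (simp add: c_def)
qed

lemma log_kernel_absolutely_integrable:
  assumes x: "x > 0"
  shows "log_kernel m x absolutely_integrable_on {0..1}"
proof (rule measurable_bounded_by_integrable_imp_absolutely_integrable)
  have "log_kernel m x \<in> borel_measurable borel"
    unfolding log_kernel_def by measurable
  then show "log_kernel m x \<in> borel_measurable (lebesgue_on {0..1})"
    by (simp add: borel_measurable_if_D measurable_completion measurable_restrict_space1)
  show "(\<lambda>t. (2 * (real m + 1) / x) ^ m * t powr (x / 2 - 1)) integrable_on {0..1}"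
    using x integrable_on_mult_right[OF integrable_on_powr_from_0[of "x / 2 - 1" 1]] by simp
  show "norm (log_kernel m x t) \<le> (2 * (real m + 1) / x) ^ m * t powr (x / 2 - 1)"
    if "t \<in> {0..1}" for t
    using log_kernel_bound[OF x] that by simp
qed simp

lemma log_kernel_integrable:
  "x > 0 \<Longrightarrow> log_kernel m x integrable_on {0..1}"
  using log_kernel_absolutely_integrable set_lebesgue_integral_eq_integral(1) by blast

lemma exp_linear_remainder:
  fixes u :: real
  shows "\<bar>exp u - 1 - u\<bar> \<le> u\<^sup>2 * exp \<bar>u\<bar>"
proof -
  obtain s where s: "\<bar>s\<bar> \<le> \<bar>u\<bar>" "exp u = (\<Sum>k<2. u ^ k / fact k) + exp s / fact 2 * u\<^sup>2"
    using Maclaurin_exp_le[of u 2] by blast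
  have "exp u - 1 - u = u\<^sup>2 * (exp s / 2)"
    using s(2) by (simp add: numeral_2_eq_2)
  then have "\<bar>exp u - 1 - u\<bar> = u\<^sup>2 * (exp s / 2)"
    by (simp only: abs_mult) simp
  also have "exp s / 2 \<le> exp s" by simp
  also have "exp s \<le> exp \<bar>u\<bar>" using s(1) by simp
  finally show ?thesis by (simp add: mult_left_mono)
qed

text \<open>
  Changing the parameter by \<open>h\<close> multiplies the kernel by \<open>exp (h * ln t)\<close>, and each derivative in
  \<open>x\<close> multiplies it by \<open>ln t\<close>. The quadratic remainder of the exponential carries the factor
  \<open>exp \<bar>h * ln t\<bar> = t powr (- \<bar>h\<bar>)\<close>, which the condition \<open>\<bar>h\<bar> \<le> x / 2\<close> absorbs by lowering the
  parameter to \<open>x / 2\<close>.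
\<close>

lemma log_kernel_taylor:
  assumes h: "\<bar>h\<bar> \<le> x / 2" and t: "0 \<le> t" "t \<le> 1"
  shows "\<bar>log_kernel m (x + h) t - log_kernel m x t - h * log_kernel (Suc m) x t\<bar>
           \<le> h\<^sup>2 * \<bar>log_kernel (m + 2) (x / 2) t\<bar>"
proof (cases "t = 0")
  case True
  then show ?thesis by (simp add: log_kernel_def)
next
  case False
  with t have t0: "t > 0" by simp
  define u where "u = h * ln t"
  have shift: "log_kernel m (x + h) t = log_kernel m x t * exp u"
    using t0 by (simp add: log_kernel_def u_def powr_def exp_add[symmetric] algebra_simps)
  have step: "h * log_kernel (Suc m) x t = log_kernel m x t * u"
    by (simp add: log_kernel_def u_def)
  have ln0: "ln t \<le> 0" using t t0 by simp
  have "\<bar>u\<bar> = \<bar>h\<bar> * (- ln t)" using ln0 by (simp add: u_def abs_mult)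
  also have "\<dots> \<le> x / 2 * (- ln t)" using h ln0 by (intro mult_right_mono) auto
  finally have u: "exp \<bar>u\<bar> \<le> exp (- (x / 2) * ln t)" by simp
  have "log_kernel m (x + h) t - log_kernel m x t - h * log_kernel (Suc m) x t
          = log_kernel m x t * (exp u - 1 - u)"
    unfolding shift step by (simp add: algebra_simps)
  then have "\<bar>log_kernel m (x + h) t - log_kernel m x t - h * log_kernel (Suc m) x t\<bar>
          = \<bar>log_kernel m x t\<bar> * \<bar>exp u - 1 - u\<bar>"
    by (simp add: abs_mult)
  also have "\<dots> \<le> \<bar>log_kernel m x t\<bar> * (u\<^sup>2 * exp \<bar>u\<bar>)"
    by (intro mult_left_mono exp_linear_remainder) simp
  also have "\<dots> \<le> \<bar>log_kernel m x t\<bar> * (u\<^sup>2 * exp (- (x / 2) * ln t))"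
    using u by (intro mult_left_mono) auto
  also have "\<dots> = h\<^sup>2 * \<bar>log_kernel (m + 2) (x / 2) t\<bar>"
  proof -
    have "t powr (x / 2 - 1) = t powr (x - 1) * exp (- (x / 2) * ln t)"
      using t0 by (simp add: powr_def exp_add[symmetric] algebra_simps)
    then show ?thesis
      using t0 by (simp add: log_kernel_def u_def abs_mult power_abs power_add power_mult_distrib
          power2_eq_square)
  qed
  finally show ?thesis .
qed

lemma log_kernel_integral_has_derivative:
  assumes x: "x > 0"
  shows "((\<lambda>x. integral {0..1} (log_kernel m x)) has_real_derivative
           integral {0..1} (log_kernel (Suc m) x)) (at x)"
proof -
  define F where "F k y = integral {0..1} (log_kernel k y)" for k y
  define C where "C = integral {0..1} (\<lambda>t. \<bar>log_kernel (m + 2) (x / 2) t\<bar>)"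
  have abs_int: "(\<lambda>t. \<bar>log_kernel (m + 2) (x / 2) t\<bar>) integrable_on {0..1}"
    using log_kernel_absolutely_integrable[of "x / 2" "m + 2"] x
    by (simp add: absolutely_integrable_on_def)
  have quotient: "\<bar>(F m (x + h) - F m x) / h - F (Suc m) x\<bar> \<le> C * \<bar>h\<bar>"
    if h: "h \<noteq> 0" "\<bar>h\<bar> \<le> x / 2" for h
  proof -
    have pos: "x + h > 0" using h x by linarith
    note int = log_kernel_integrable[OF pos, of m] log_kernel_integrable[OF x, of m]
      log_kernel_integrable[OF x, of "Suc m"]
    let ?r = "\<lambda>t. log_kernel m (x + h) t - log_kernel m x t - h * log_kernel (Suc m) x t"
    have r: "(?r has_integral F m (x + h) - F m x - h * F (Suc m) x) {0..1}"
      unfolding F_def using int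
      by (intro has_integral_diff has_integral_mult_right integrable_integral)
    have "\<bar>integral {0..1} ?r\<bar> \<le> integral {0..1} (\<lambda>t. h\<^sup>2 * \<bar>log_kernel (m + 2) (x / 2) t\<bar>)"
      unfolding real_norm_def[symmetric]
    proof (rule integral_norm_bound_integral)
      show "?r integrable_on {0..1}" using r by blast
      show "(\<lambda>t. h\<^sup>2 * norm (log_kernel (m + 2) (x / 2) t)) integrable_on {0..1}"
        using integrable_on_mult_right[OF abs_int] by simp
    qed (use log_kernel_taylor[OF h(2)] in simp)
    then have "\<bar>F m (x + h) - F m x - h * F (Suc m) x\<bar> \<le> h\<^sup>2 * C"
      using integral_unique[OF r] by (simp add: C_def)
    then have "\<bar>F m (x + h) - F m x - h * F (Suc m) x\<bar> / \<bar>h\<bar> \<le> h\<^sup>2 * C / \<bar>h\<bar>"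
      by (intro divide_right_mono) auto
    moreover have "\<bar>F m (x + h) - F m x - h * F (Suc m) x\<bar> / \<bar>h\<bar>
        = \<bar>(F m (x + h) - F m x) / h - F (Suc m) x\<bar>"
      using h by (simp add: abs_divide[symmetric] diff_divide_distrib)
    moreover have "h\<^sup>2 * C / \<bar>h\<bar> = C * \<bar>h\<bar>"
      using h by (simp add: power2_eq_square field_simps abs_mult[symmetric])
    ultimately show ?thesis by simp
  qed
  have "((\<lambda>h. (F m (x + h) - F m x) / h - F (Suc m) x) \<longlongrightarrow> 0) (at 0)"
  proof (rule Lim_null_comparison)
    have "eventually (\<lambda>h. h \<in> {- (x / 2)<..<x / 2} - {0}) (at (0::real))"
      using x by (intro eventually_at_in_open) auto
    then show "\<forall>\<^sub>F h in at 0. norm ((F m (x + h) - F m x) / h - F (Suc m) x) \<le> C * \<bar>h\<bar>"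
      by eventually_elim (auto intro!: quotient)
    show "((\<lambda>h. C * \<bar>h\<bar>) \<longlongrightarrow> 0) (at 0)"
      by (auto intro!: tendsto_eq_intros)
  qed
  then have "(\<lambda>h. (F m (x + h) - F m x) / h) \<midarrow>0\<rightarrow> F (Suc m) x"
    by (rule LIM_zero_cancel)
  then show ?thesis unfolding F_def by (simp add: DERIV_def)
qed

lemma nielsen_beta_higher_deriv:
  assumes "x > 0"
  shows "(deriv ^^ m) nielsen_beta x = integral {0..1} (log_kernel m x)"
  using assms
proof (induction m arbitrary: x)
  case 0
  then show ?case by (simp add: nielsen_beta_def log_kernel_def[abs_def])
next
  case (Suc m)
  have "\<forall>\<^sub>F y in nhds x. y > 0"
    using Suc.prems eventually_nhds_in_open[of "{0<..}" x] by simp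
  then have "\<forall>\<^sub>F y in nhds x. (deriv ^^ m) nielsen_beta y = integral {0..1} (log_kernel m y)"
    by eventually_elim (rule Suc.IH)
  then have "deriv ((deriv ^^ m) nielsen_beta) x
      = deriv (\<lambda>y. integral {0..1} (log_kernel m y)) x"
    by (intro deriv_cong_ev) auto
  also have "\<dots> = integral {0..1} (log_kernel (Suc m) x)"
    using log_kernel_integral_has_derivative[OF Suc.prems] by (rule DERIV_imp_deriv)
  finally show ?case by simp
qed

lemma convex_on_integral:
  fixes f :: "'a::real_vector \<Rightarrow> 'b::euclidean_space \<Rightarrow> real"
  assumes "convex S"
    and int: "\<And>x. x \<in> S \<Longrightarrow> f x integrable_on T"
    and conv: "\<And>t. t \<in> T \<Longrightarrow> convex_on S (\<lambda>x. f x t)"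
  shows "convex_on S (\<lambda>x. integral T (f x))"
  unfolding convex_on_def
proof (intro conjI ballI allI impI)
  fix x y and u v :: real
  assume xy: "x \<in> S" "y \<in> S" and uv: "u \<ge> 0" "v \<ge> 0" "u + v = 1"
  have "integral T (f (u *\<^sub>R x + v *\<^sub>R y)) \<le> integral T (\<lambda>t. u * f x t + v * f y t)"
  proof (rule integral_le)
    show "f (u *\<^sub>R x + v *\<^sub>R y) integrable_on T"
      using \<open>convex S\<close> xy uv by (intro int) (auto simp: convex_def)
    show "(\<lambda>t. u * f x t + v * f y t) integrable_on T"
      using int xy by (intro integrable_add integrable_on_mult_right) auto
  qed (use conv xy uv in \<open>auto simp: convex_on_def\<close>)
  also have "\<dots> = u * integral T (f x) + v * integral T (f y)"
    using int xy by (simp add: integral_add integrable_on_mult_right)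
  finally show "integral T (f (u *\<^sub>R x + v *\<^sub>R y)) \<le> u * integral T (f x) + v * integral T (f y)" .
qed fact

lemma convex_on_exp_mult:
  "convex_on UNIV (\<lambda>x::real. exp (c * x))"
  by (rule convex_on_realI[where f' = "\<lambda>x. c * exp (c * x)"])
    (auto intro!: derivative_eq_intros simp: mult_left_mono mult_le_cancel_left)

lemma convex_on_exp_times_log_kernel:
  assumes "even m" and t: "0 \<le> t"
  shows "convex_on {0<..} (\<lambda>x. exp (a * x) * log_kernel m x t)"
proof (cases "t = 0")
  case True
  then show ?thesis by (simp add: log_kernel_def convex_on_def)
next
  case False
  with t have t0: "t > 0" by simp
  define w where "w = ln t ^ m / (t * (1 + t))"
  have w: "w \<ge> 0" using t0 \<open>even m\<close> by (simp add: w_def zero_le_even_power)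
  have "exp (a * x) * log_kernel m x t = w * exp ((a + ln t) * x)" for x
  proof -
    have "t powr (x - 1) = exp (x * ln t) / t"
      using t0 by (simp add: powr_diff) (simp add: powr_def)
    moreover have "exp ((a + ln t) * x) = exp (a * x) * exp (x * ln t)"
      by (simp add: exp_add[symmetric] algebra_simps)
    ultimately show ?thesis by (simp add: w_def log_kernel_def)
  qed
  then show ?thesis
    using convex_on_cmul[OF w convex_on_subset[OF convex_on_exp_mult]] by simp
qed

theorem theorem2p11:
  fixes m :: nat and a :: real
  assumes "even m"
  shows "convex_on {0<..} (\<lambda>x::real. exp (a * x) * (deriv ^^ m) nielsen_beta x)"
proof -
  have "convex_on {0<..} (\<lambda>x. integral {0..1} (\<lambda>t. exp (a * x) * log_kernel m x t))"
    using log_kernel_integrable convex_on_exp_times_log_kernel[OF assms]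
    by (intro convex_on_integral integrable_on_mult_right) auto
  moreover have "u * x + v * y > 0"
    if "x > 0" "y > 0" "u \<ge> 0" "v \<ge> 0" "u + v = 1" for x y u v :: real
    using convexD[of "{0::real<..}" x y u v] that by simp
  ultimately show ?thesis
    by (simp add: convex_on_def nielsen_beta_higher_deriv)
qed

end
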